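(* For every integer $t\ge2$, every real $\alpha\ge1$ and every positive integer $n$, $$\operatorname{spec}_\alpha^{\mathrm{ind}}(K_{1,t},n)=\max_{\substack{n_1,n_2\ge0\\ n_1+n_2=n}}\lambda_\alpha^{\mathrm{ind}}(K_{1,t},K_{n_1,n_2}),$$ where the maximum is over integers $n_1,n_2$ and parts of size zero are omitted.
   Context: Graphs are finite and simple. $K_{n_1,\ldots,n_q}$ denotes the complete multipartite graph with independent parts of sizes $n_1,\ldots,n_q$ in which any two vertices in different parts are adjacent; parts of size zero are omitted (so $K_{n,0}$ is the edgeless graph on $n$ vertices). $K_{1,t}$ is the star with $t$ leaves. Let $F$ be an $\ell$-vertex graph and $G$ an $n$-vertex graph; vectors in $\mathbb{R}^n$ are indexed by $V(G)$. Put $H_F(G)=\{S\subseteq V(G): G[S]\cong F\}$, where $G[S]$ is the induced subgraph, and $P_{F,G}(\mathbf{x})=\ell!\sum_{e\in H_F(G)}\prod_{i\in e}x_i$. For real $\alpha\ge1$ define $\lambda_\alpha^{\mathrm{ind}}(F,G)=\max\{P_{F,G}(\mathbf{x}):\mathbf{x}\in\mathbb{R}^n,\ \sum_i|x_i|^\alpha=1\}$ and $\operatorname{spec}_\alpha^{\mathrm{ind}}(F,n)=\max\{\lambda_\alpha^{\mathrm{ind}}(F,G): G\text{ an }n\text{-vertex graph}\}$. *)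

theory Defs
  imports "HOL-Analysis.Analysis" "Graph_Theory.Graph_Theory"
begin

text \<open>
  A finite simple graph is a \<open>pair_graph\<close>: finite, loop-free, and with a symmetric set of ordered
  pairs as arcs, so that \<open>digraph_iso\<close> is graph isomorphism and \<open>G \<restriction> S\<close> is the induced subgraph.
\<close>

definition complete_multipartite :: "nat list \<Rightarrow> (nat \<times> nat) pair_pre_digraph" where
  "complete_multipartite ns =
     (let V = {(p, k). p < length ns \<and> k < ns ! p}
      in \<lparr> pverts = V, parcs = {(u, v). u \<in> V \<and> v \<in> V \<and> fst u \<noteq> fst v} \<rparr>)"

definition induced_copies :: "'b pair_pre_digraph \<Rightarrow> 'a pair_pre_digraph \<Rightarrow> 'a set set" where
  "induced_copies F G = {S. S \<subseteq> pverts G \<and> digraph_iso (with_proj G \<restriction> S) (with_proj F)}"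

text \<open>Only the values of \<open>x\<close> on the vertices of \<open>G\<close> are relevant below.\<close>

definition ind_poly :: "'b pair_pre_digraph \<Rightarrow> 'a pair_pre_digraph \<Rightarrow> ('a \<Rightarrow> real) \<Rightarrow> real" where
  "ind_poly F G x = fact (card (pverts F)) * (\<Sum>e\<in>induced_copies F G. \<Prod>i\<in>e. x i)"

text \<open>
  \<open>Max\<close> is only meaningful for finite sets; \<open>GREATEST r. r \<in> A\<close> is the maximum of an arbitrary set
  \<open>A\<close>, provided that \<open>A\<close> has one. Here it does whenever \<open>G\<close> has a vertex, by \<open>lambda_ind_attained\<close>
  below.
\<close>

definition lambda_ind :: "real \<Rightarrow> 'b pair_pre_digraph \<Rightarrow> 'a pair_pre_digraph \<Rightarrow> real" where
  "lambda_ind \<alpha> F G =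
     (GREATEST r. r \<in> {ind_poly F G x | x. (\<Sum>i\<in>pverts G. \<bar>x i\<bar> powr \<alpha>) = 1})"

text \<open>
  Every graph on \<open>n\<close> vertices is isomorphic to one whose vertices are natural numbers, and there
  are only finitely many isomorphism types.
\<close>

definition spec_ind :: "real \<Rightarrow> 'b pair_pre_digraph \<Rightarrow> nat \<Rightarrow> real" where
  "spec_ind \<alpha> F n =
     (GREATEST r. r \<in> {lambda_ind \<alpha> F G | G :: nat pair_pre_digraph.
                         pair_graph G \<and> card (pverts G) = n})"

lemma complete_bipartite_digraph_complete_multipartite:
  "complete_bipartite_digraph m n (with_proj (complete_multipartite [m, n]))"
proof -
  let ?U = "{0} \<times> {..<m}" and ?W = "{1} \<times> {..<n}"
  have V: "pverts (complete_multipartite [m, n]) = ?U \<union> ?W"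
    by (auto simp: complete_multipartite_def Let_def less_Suc_eq)
  have A: "parcs (complete_multipartite [m, n]) = ?U \<times> ?W \<union> ?W \<times> ?U"
    by (auto simp: complete_multipartite_def Let_def less_Suc_eq)
  show ?thesis
    unfolding complete_bipartite_digraph_pair_def
    unfolding V A by (intro conjI exI[of _ ?U] exI[of _ ?W]) (simp_all add: card_cartesian_product, blast)
qed

lemma lambda_ind_attained:
  fixes G :: "'a pair_pre_digraph"
  assumes fin: "finite (pverts G)" and ne: "pverts G \<noteq> {}" and \<alpha>: "\<alpha> \<ge> 1"
  defines "X \<equiv> {x. (\<Sum>i\<in>pverts G. \<bar>x i\<bar> powr \<alpha>) = 1}"
  shows "\<exists>x\<in>X. lambda_ind \<alpha> F G = ind_poly F G x" "\<forall>x\<in>X. ind_poly F G x \<le> lambda_ind \<alpha> F G"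
proof -
  let ?V = "pverts G"
  define B where "B = PiE UNIV (\<lambda>i. if i \<in> ?V then {-1..1::real} else {0})"
  have cB: "compact B"
  proof -
    have "compactin (product_topology (\<lambda>_. euclidean) UNIV) B"
      unfolding B_def by (subst compactin_PiE) auto
    then show ?thesis
      by (simp add: euclidean_product_topology)
  qed
  have "continuous_on UNIV (\<lambda>x. \<Sum>i\<in>?V. \<bar>x i\<bar> powr \<alpha>)"
    using \<alpha> by (intro continuous_on_sum continuous_on_powr' continuous_on_rabs
        continuous_on_product_coordinates continuous_on_const) auto
  then have "closed X"
    unfolding X_def by (intro closed_Collect_eq continuous_on_const)
  with cB have cpt: "compact (X \<inter> B)"
    by (metis closed_Int_compact)
  have cont: "continuous_on A (ind_poly F G)" for A
    unfolding ind_poly_def[abs_def]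
    by (intro continuous_on_mult continuous_on_sum continuous_on_prod
        continuous_on_product_coordinates continuous_on_const
        continuous_on_subset[OF continuous_on_product_coordinates]) auto
  have restr: "(\<lambda>i. if i \<in> ?V then x i else 0) \<in> X \<inter> B"
      "ind_poly F G (\<lambda>i. if i \<in> ?V then x i else 0) = ind_poly F G x" if "x \<in> X" for x
  proof -
    have le: "\<bar>x i\<bar> \<le> 1" if "i \<in> ?V" for i
    proof (rule ccontr)
      assume "\<not> \<bar>x i\<bar> \<le> 1"
      then have "1 < \<bar>x i\<bar> powr \<alpha>" using \<alpha> by (intro gr_one_powr) auto
      also have "\<dots> \<le> (\<Sum>i\<in>?V. \<bar>x i\<bar> powr \<alpha>)"
        using fin that by (intro member_le_sum) auto
      finally show False using \<open>x \<in> X\<close> by (simp add: X_def)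
    qed
    show "(\<lambda>i. if i \<in> ?V then x i else 0) \<in> X \<inter> B"
    proof
      show "(\<lambda>i. if i \<in> ?V then x i else 0) \<in> X"
        using \<open>x \<in> X\<close> by (simp add: X_def)
      have "- 1 \<le> x i" "x i \<le> 1" if "i \<in> ?V" for i
        using le[OF that] by linarith+
      then show "(\<lambda>i. if i \<in> ?V then x i else 0) \<in> B"
        by (simp add: B_def PiE_iff)
    qed
    show "ind_poly F G (\<lambda>i. if i \<in> ?V then x i else 0) = ind_poly F G x"
    proof -
      have "(\<Prod>i\<in>e. if i \<in> ?V then x i else 0) = (\<Prod>i\<in>e. x i)" if "e \<in> induced_copies F G" for e
        using that by (intro prod.cong refl) (auto simp: induced_copies_def)
      then show ?thesis
        by (simp add: ind_poly_def)
    qed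
  qed
  obtain v where v: "v \<in> ?V" using ne by blast
  have "(\<lambda>i. if i = v then 1 else 0) \<in> X"
  proof -
    have "(\<Sum>i\<in>?V. \<bar>if i = v then 1 else 0 :: real\<bar> powr \<alpha>) = (\<Sum>i\<in>?V. if i = v then 1 else 0)"
      by (intro sum.cong) auto
    with fin v show ?thesis by (simp add: X_def)
  qed
  then have "X \<inter> B \<noteq> {}" using restr(1) by blast
  then obtain y where y: "y \<in> X \<inter> B" "\<forall>x\<in>X \<inter> B. ind_poly F G x \<le> ind_poly F G y"
    using continuous_attains_sup[OF cpt _ cont] by blast
  have max: "ind_poly F G x \<le> ind_poly F G y" if "x \<in> X" for x
    using y(2) restr[OF that] by metis
  have "lambda_ind \<alpha> F G = ind_poly F G y"
    unfolding lambda_ind_def using y(1) max by (intro Greatest_equality) (auto simp: X_def)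
  with y(1) max show "\<exists>x\<in>X. lambda_ind \<alpha> F G = ind_poly F G x"
    "\<forall>x\<in>X. ind_poly F G x \<le> lambda_ind \<alpha> F G" by auto
qed

end

theory Submission
  imports Defs
begin

text \<open>
  Replacing \<open>x\<close> by its absolute value does not decrease the polynomial and keeps the norm, so it
  suffices to compare, for a fixed nonnegative weighting \<open>x\<close> of a fixed finite vertex set, the
  weighted number of induced stars in an arbitrary graph with that in a complete bipartite graph.
  By \<open>star_sum_le_bipartite\<close> some bipartition of the vertex set does at least as well as the
  given graph.  Its proof has two steps.

  The first is symmetrization (\<open>star_sum_clone\<close>).  Let \<open>u\<close> and \<open>v\<close> be nonadjacent, and turn \<open>v\<close>
  into a copy of \<open>u\<close>.  Stars that contain both survive, because nonadjacent vertices of a star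
  are both leaves and so already look alike from inside the star.  Stars that contain exactly one
  of the two contribute \<open>x u * L u + x v * L v\<close> before and \<open>x u * L u + x v * L u\<close> after, where
  \<open>L\<close> is \<open>link_sum\<close>.  If all weights are positive and the graph is optimal, then \<open>L u = L v\<close>, and
  cloning in either direction leaves the graph optimal.  Among the optimal graphs take one with
  the largest weighted number of edges.  Edges are stars with one leaf, so the same argument shows
  that nonadjacent vertices have the same weighted degree.  Suppose now that \<open>u\<close>, \<open>v\<close> and \<open>v\<close>, \<open>w\<close>
  are nonadjacent, but \<open>u\<close>, \<open>w\<close> are adjacent.  Turning \<open>u\<close> into a copy of \<open>v\<close> gives another
  graph of the same kind in which \<open>v\<close> and \<open>w\<close> are still nonadjacent, but \<open>w\<close> has lost the
  neighbour \<open>u\<close> while \<open>v\<close> has lost none, a contradiction.  Hence nonadjacency is transitive and the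
  graph is complete multipartite (\<open>star_sum_le_multipartite\<close>).

  The second step merges parts (\<open>merge_parts\<close>).  In a complete multipartite graph the count is
  \<open>\<Sum>k. e\<^sub>t(V\<^sub>k) * (s - s\<^sub>k)\<close>, with \<open>e\<^sub>t\<close> the elementary symmetric polynomial of the weights in the
  part \<open>V\<^sub>k\<close>, with \<open>s\<^sub>k\<close> the weight of that part and \<open>s\<close> the total weight.  If there are three parts
  or more, two parts other than a heaviest one can be merged without loss (\<open>esym_merge\<close>).

  Vertices of weight zero contribute nothing, so the positivity needed in the first step costs
  nothing.  The remaining lemmas translate between graph isomorphism and the concrete description
  of stars.
\<close>

section \<open>Weighted counts of induced stars\<close>

text \<open>
  A set \<open>S\<close> induces a star with centre \<open>c\<close> if the edges inside \<open>S\<close> are the pairs that contain \<open>c\<close>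
  exactly once.  In this form the condition includes symmetry and the absence of loops on \<open>S\<close>,
  and it is visibly invariant under relabelling.
\<close>

definition induces_star :: "('a \<Rightarrow> 'a \<Rightarrow> bool) \<Rightarrow> nat \<Rightarrow> 'a set \<Rightarrow> bool" where
  "induces_star E t S \<longleftrightarrow>
     card S = Suc t \<and> (\<exists>c\<in>S. \<forall>u\<in>S. \<forall>v\<in>S. E u v \<longleftrightarrow> (u = c) \<noteq> (v = c))"

definition star_sum :: "('a \<Rightarrow> 'a \<Rightarrow> bool) \<Rightarrow> nat \<Rightarrow> 'a set \<Rightarrow> ('a \<Rightarrow> real) \<Rightarrow> real" where
  "star_sum E t V x = (\<Sum>S | S \<subseteq> V \<and> induces_star E t S. \<Prod>i\<in>S. x i)"

lemma induces_star_image: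
  assumes "inj_on h S"
  shows "induces_star E t (h ` S) \<longleftrightarrow> induces_star (\<lambda>u v. E (h u) (h v)) t S"
proof -
  have "h u = h c \<longleftrightarrow> u = c" if "u \<in> S" "c \<in> S" for u c
    using assms that by (auto dest: inj_onD)
  then show ?thesis
    unfolding induces_star_def using card_image[OF assms] by auto
qed

lemma induces_star_cong:
  assumes "\<And>u v. u \<in> S \<Longrightarrow> v \<in> S \<Longrightarrow> E u v \<longleftrightarrow> E' u v"
  shows "induces_star E t S \<longleftrightarrow> induces_star E' t S"
  unfolding induces_star_def using assms by auto

lemma star_sum_cong:
  assumes "\<And>u v. u \<in> V \<Longrightarrow> v \<in> V \<Longrightarrow> E u v \<longleftrightarrow> E' u v"
  shows "star_sum E t V x = star_sum E' t V x"
proof -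
  have "{S. S \<subseteq> V \<and> induces_star E t S} = {S. S \<subseteq> V \<and> induces_star E' t S}"
    using assms by (intro Collect_cong conj_cong refl induces_star_cong) auto
  then show ?thesis by (simp add: star_sum_def)
qed

lemma star_sum_reindex:
  assumes h: "bij_betw h V V'"
    and E: "\<And>u v. u \<in> V \<Longrightarrow> v \<in> V \<Longrightarrow> E u v \<longleftrightarrow> E' (h u) (h v)"
  shows "star_sum E t V (\<lambda>v. x (h v)) = star_sum E' t V' x"
proof -
  have inj: "inj_on h V" and im: "h ` V = V'"
    using h by (auto simp: bij_betw_def)
  have star: "induces_star E t S \<longleftrightarrow> induces_star E' t (h ` S)" if "S \<subseteq> V" for S
  proof -
    have "induces_star E' t (h ` S) \<longleftrightarrow> induces_star (\<lambda>u v. E' (h u) (h v)) t S"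
      using inj that by (intro induces_star_image) (auto intro: inj_on_subset)
    also have "\<dots> \<longleftrightarrow> induces_star E t S"
      using E that by (intro induces_star_cong) auto
    finally show ?thesis by simp
  qed
  have "bij_betw ((`) h) {S. S \<subseteq> V \<and> induces_star E t S} {S. S \<subseteq> V' \<and> induces_star E' t S}"
    unfolding bij_betw_def
  proof
    show "inj_on ((`) h) {S. S \<subseteq> V \<and> induces_star E t S}"
      using inj by (auto simp: inj_on_def inj_on_image_eq_iff[OF inj])
    show "(`) h ` {S. S \<subseteq> V \<and> induces_star E t S} = {S. S \<subseteq> V' \<and> induces_star E' t S}"
    proof safe
      fix S assume "S \<subseteq> V'" "induces_star E' t S"
      moreover from \<open>S \<subseteq> V'\<close> obtain R where "R \<subseteq> V" "S = h ` R"
        unfolding im[symmetric] by (auto simp: subset_image_iff)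
      ultimately show "S \<in> (`) h ` {S. S \<subseteq> V \<and> induces_star E t S}"
        using star by auto
    qed (use star im in auto)
  qed
  then have "star_sum E' t V' x = (\<Sum>S | S \<subseteq> V \<and> induces_star E t S. \<Prod>i\<in>h ` S. x i)"
    unfolding star_sum_def by (rule sum.reindex_bij_betw[symmetric])
  also have "\<dots> = star_sum E t V (\<lambda>v. x (h v))"
    unfolding star_sum_def using inj
    by (intro sum.cong refl prod.reindex_cong[OF _ refl refl]) (auto intro: inj_on_subset)
  finally show ?thesis by simp
qed

text \<open>
  This reduces nonnegative weights to positive ones: a star with a vertex of weight zero has
  weight zero.
\<close>

lemma star_sum_support:
  assumes "finite V"
  shows "star_sum E t {v\<in>V. x v \<noteq> 0} x = star_sum E t V x"
  unfolding star_sum_def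
proof (rule sum.mono_neutral_left)
  show "\<forall>S\<in>{S. S \<subseteq> V \<and> induces_star E t S} - {S. S \<subseteq> {v \<in> V. x v \<noteq> 0} \<and> induces_star E t S}.
          prod x S = 0"
    using assms by (auto simp: prod_zero_iff[OF finite_subset])
qed (use assms in auto)

lemma star_sum_le_abs: "star_sum E t V x \<le> star_sum E t V (\<lambda>v. \<bar>x v\<bar>)"
  unfolding star_sum_def by (intro sum_mono) (metis abs_ge_self abs_prod)

section \<open>Cloning a vertex\<close>

text \<open>
  The vertex \<open>v\<close> becomes a copy of \<open>u\<close>.  Pulling the relation back along the map that sends \<open>v\<close>
  to \<open>u\<close> makes the two nonadjacent whenever \<open>u\<close> has no loop.
\<close>

definition clone :: "('a \<Rightarrow> 'a \<Rightarrow> bool) \<Rightarrow> 'a \<Rightarrow> 'a \<Rightarrow> 'a \<Rightarrow> 'a \<Rightarrow> bool" where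
  "clone E u v = (\<lambda>a b. E ((id(v := u)) a) ((id(v := u)) b))"

text \<open>
  This is the coefficient of \<open>x u\<close> in the part of the star sum that comes from the stars avoiding
  \<open>v\<close>.
\<close>

definition link_sum :: "('a \<Rightarrow> 'a \<Rightarrow> bool) \<Rightarrow> nat \<Rightarrow> 'a set \<Rightarrow> ('a \<Rightarrow> real) \<Rightarrow> 'a \<Rightarrow> 'a \<Rightarrow> real" where
  "link_sum E t V x u v =
     (\<Sum>R | R \<subseteq> V - {u, v} \<and> induces_star E t (insert u R). \<Prod>i\<in>R. x i)"

text \<open>
  The stars are sorted by which of \<open>u\<close> and \<open>v\<close> they contain, so that the effect of cloning can be
  read off term by term.
\<close>

lemma star_sum_split:
  assumes V: "finite V" "u \<in> V" "v \<in> V" "u \<noteq> v"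
  shows "star_sum E t V x =
    star_sum E t (V - {u, v}) x + x u * link_sum E t V x u v + x v * link_sum E t V x v u
      + (\<Sum>S | S \<subseteq> V \<and> u \<in> S \<and> v \<in> S \<and> induces_star E t S. \<Prod>i\<in>S. x i)"
proof -
  let ?A = "{S. S \<subseteq> V - {u, v} \<and> induces_star E t S}"
  let ?B = "\<lambda>u v. {S. S \<subseteq> V \<and> u \<in> S \<and> v \<notin> S \<and> induces_star E t S}"
  let ?C = "{S. S \<subseteq> V \<and> u \<in> S \<and> v \<in> S \<and> induces_star E t S}"
  have B: "(\<Sum>S\<in>?B u v. \<Prod>i\<in>S. x i) = x u * link_sum E t V x u v" if "u \<in> V" "u \<noteq> v" for u v
  proof -
    let ?L = "{R. R \<subseteq> V - {u, v} \<and> induces_star E t (insert u R)}"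
    have "bij_betw (insert u) ?L (?B u v)"
    proof (rule bij_betwI[where g = "\<lambda>S. S - {u}"])
      show "(\<lambda>S. S - {u}) \<in> ?B u v \<rightarrow> ?L"
        using that by (auto simp: insert_absorb)
    qed (use that in auto)
    then have "(\<Sum>S\<in>?B u v. \<Prod>i\<in>S. x i) = (\<Sum>R\<in>?L. \<Prod>i\<in>insert u R. x i)"
      by (rule sum.reindex_bij_betw[symmetric])
    also have "\<dots> = (\<Sum>R\<in>?L. x u * (\<Prod>i\<in>R. x i))"
    proof (rule sum.cong[OF refl])
      fix R assume "R \<in> ?L"
      then have "finite R" "u \<notin> R" using \<open>finite V\<close> by (auto intro: finite_subset)
      then show "(\<Prod>i\<in>insert u R. x i) = x u * (\<Prod>i\<in>R. x i)" by simp
    qed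
    finally show ?thesis by (simp add: link_sum_def sum_distrib_left)
  qed
  have U: "{S. S \<subseteq> V \<and> induces_star E t S} = ((?A \<union> ?B u v) \<union> ?B v u) \<union> ?C"
    by auto
  have "finite ?A" "finite (?B u v)" "finite (?B v u)" "finite ?C"
    using V by auto
  then have "star_sum E t V x =
      ((\<Sum>S\<in>?A. \<Prod>i\<in>S. x i) + (\<Sum>S\<in>?B u v. \<Prod>i\<in>S. x i)) + (\<Sum>S\<in>?B v u. \<Prod>i\<in>S. x i)
        + (\<Sum>S\<in>?C. \<Prod>i\<in>S. x i)"
    unfolding star_sum_def U
    by (subst sum.union_disjoint; (simp; fail)?; (blast)?)+
  then show ?thesis
    using V B[of u v] B[of v u] by (simp add: star_sum_def)
qed

text \<open>
  Symmetrization: stars avoiding \<open>v\<close> are unaffected, stars containing \<open>v\<close> but not \<open>u\<close> become as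
  many as those containing \<open>u\<close> but not \<open>v\<close>, and stars containing both survive.
\<close>

lemma star_sum_clone:
  assumes V: "finite V" "u \<in> V" "v \<in> V" "u \<noteq> v" and nonadj: "\<not> E u v"
    and x: "\<And>i. i \<in> V \<Longrightarrow> 0 \<le> x i"
  shows "star_sum E t V x + x v * (link_sum E t V x u v - link_sum E t V x v u)
           \<le> star_sum (clone E u v) t V x"
proof -
  let ?\<phi> = "id(v := u)"
  let ?both = "\<lambda>E. {S. S \<subseteq> V \<and> u \<in> S \<and> v \<in> S \<and> induces_star E t S}"
  have star: "induces_star (clone E u v) t S \<longleftrightarrow> induces_star E t (?\<phi> ` S)" if "\<not> (u \<in> S \<and> v \<in> S)" for S
    unfolding clone_def using that by (subst induces_star_image) (auto simp: inj_on_def)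
  have keep: "induces_star (clone E u v) t S \<longleftrightarrow> induces_star E t S" if "v \<notin> S" for S
  proof -
    have "?\<phi> ` S = S" using that by (auto simp: image_iff)
    then show ?thesis using star[of S] that by simp
  qed
  have 1: "star_sum (clone E u v) t (V - {u, v}) x = star_sum E t (V - {u, v}) x"
    unfolding star_sum_def using keep by (intro sum.cong refl) blast
  have 2: "link_sum (clone E u v) t V x u v = link_sum E t V x u v"
    unfolding link_sum_def using \<open>u \<noteq> v\<close> keep[of "insert u _"] by (intro sum.cong refl) blast
  have 3: "link_sum (clone E u v) t V x v u = link_sum E t V x u v"
  proof -
    have "induces_star (clone E u v) t (insert v R) \<longleftrightarrow> induces_star E t (insert u R)"
      if "R \<subseteq> V - {u, v}" for R
    proof -
      have "?\<phi> ` insert v R = insert u R" using that by (auto simp: image_iff)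
      then show ?thesis using star[of "insert v R"] that \<open>u \<noteq> v\<close> by auto
    qed
    then show ?thesis
      unfolding link_sum_def by (intro sum.cong refl) (auto simp: insert_commute)
  qed
  \<comment> \<open>Two nonadjacent vertices of a star are leaves, so inside \<open>S\<close> a copy of
    \<open>u\<close> has the neighbours that \<open>v\<close> had.\<close>
  have 4: "?both E \<subseteq> ?both (clone E u v)"
  proof safe
    fix S assume S: "u \<in> S" "v \<in> S" "induces_star E t S"
    then obtain c where c: "c \<in> S" "\<forall>a\<in>S. \<forall>b\<in>S. E a b \<longleftrightarrow> (a = c) \<noteq> (b = c)"
      by (auto simp: induces_star_def)
    with S nonadj \<open>u \<noteq> v\<close> have "u \<noteq> c" "v \<noteq> c" by auto
    with S c show "induces_star (clone E u v) t S"
      by (auto simp: induces_star_def clone_def)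
  qed
  have 5: "(\<Sum>S\<in>?both E. \<Prod>i\<in>S. x i) \<le> (\<Sum>S\<in>?both (clone E u v). \<Prod>i\<in>S. x i)"
    using V x by (intro sum_mono2 4 prod_nonneg) auto
  show ?thesis
    unfolding star_sum_split[OF V, of E] star_sum_split[OF V, of "clone E u v"] 1 2 3
    using 5 by (simp add: algebra_simps)
qed

text \<open>
  An edge is a star with one leaf, so for one leaf the link sum is the weighted degree (up to the
  possible neighbour \<open>v\<close>).  This makes \<open>star_sum_clone\<close> available for weighted edge counts as well.
\<close>

lemma link_sum_edge:
  assumes "finite V" and "\<And>a b. E a b \<longleftrightarrow> E b a" and "\<And>a. \<not> E a a"
  shows "link_sum E 1 V x u v = (\<Sum>a | a \<in> V - {u, v} \<and> E u a. x a)"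
proof -
  have star: "induces_star E 1 (insert u R) \<longleftrightarrow> (\<exists>a. R = {a} \<and> E u a)" if "u \<notin> R" "finite R" for R
  proof -
    have "card (insert u R) = Suc 1 \<longleftrightarrow> (\<exists>a. R = {a})"
      using that by (auto simp: card_1_singleton_iff)
    then show ?thesis
      unfolding induces_star_def using assms(2,3) that by auto
  qed
  have "bij_betw (\<lambda>a. {a}) {a. a \<in> V - {u, v} \<and> E u a}
          {R. R \<subseteq> V - {u, v} \<and> induces_star E 1 (insert u R)}"
    unfolding bij_betw_def
  proof
    have "R \<in> (\<lambda>a. {a}) ` {a. a \<in> V - {u, v} \<and> E u a} \<longleftrightarrow>
          R \<subseteq> V - {u, v} \<and> induces_star E 1 (insert u R)" for R
    proof (cases "R \<subseteq> V - {u, v}")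
      case True
      then have "u \<notin> R" "finite R" using assms(1) by (auto intro: finite_subset)
      with star[of R] True show ?thesis by auto
    qed auto
    then show "(\<lambda>a. {a}) ` {a. a \<in> V - {u, v} \<and> E u a} =
          {R. R \<subseteq> V - {u, v} \<and> induces_star E 1 (insert u R)}" by blast
  qed auto
  from sum.reindex_bij_betw[OF this, of "prod x"] show ?thesis
    by (simp add: link_sum_def)
qed


section \<open>Reduction to complete multipartite graphs\<close>

lemma symp_clone: "symp E \<Longrightarrow> symp (clone E u v)"
  unfolding clone_def symp_def by blast

lemma irreflp_clone: "irreflp E \<Longrightarrow> irreflp (clone E u v)"
  unfolding clone_def irreflp_def by blast

text \<open>
  Over all relations on a possibly infinite type the star sum still takes finitely many values,
  because it depends only on which subsets of \<open>V\<close> are stars.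
\<close>

lemma finite_star_sums:
  assumes "finite V"
  shows "finite ((\<lambda>E. star_sum E t V x) ` \<E>)"
proof (rule finite_subset)
  show "(\<lambda>E. star_sum E t V x) ` \<E> \<subseteq> (\<lambda>\<S>. \<Sum>S\<in>\<S>. \<Prod>i\<in>S. x i) ` Pow (Pow V)"
    by (auto simp: star_sum_def)
qed (use assms in simp)

lemma ex_greatest_star_sum:
  assumes "finite V" and "E0 \<in> \<E>"
  shows "\<exists>E\<in>\<E>. \<forall>E'\<in>\<E>. star_sum E' t V x \<le> star_sum E t V x"
proof -
  let ?A = "(\<lambda>E. star_sum E t V x) ` \<E>"
  have "finite ?A" "?A \<noteq> {}" using assms finite_star_sums by auto
  then have max: "a \<le> Max ?A" if "a \<in> ?A" for a using that by (intro Max_ge)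
  have "Max ?A \<in> ?A" using \<open>finite ?A\<close> \<open>?A \<noteq> {}\<close> by (rule Max_in)
  then obtain E where E: "Max ?A = star_sum E t V x" "E \<in> \<E>" by (rule imageE)
  have "star_sum E' t V x \<le> star_sum E t V x" if "E' \<in> \<E>" for E'
    using max[OF imageI[OF that]] unfolding E(1) .
  with E(2) show ?thesis by blast
qed

text \<open>
  A complete multipartite graph is given by a map \<open>f\<close> whose fibres are the parts.  The multipartite
  graph is one that maximizes the star sum and, among all maximizers, the weighted number of edges;
  its parts are its sets of nonneighbours.
\<close>

lemma star_sum_le_multipartite:
  fixes E :: "'a \<Rightarrow> 'a \<Rightarrow> bool"
  assumes V: "finite V" and x: "\<And>i. i \<in> V \<Longrightarrow> 0 < x i" and "symp E" "irreflp E"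
  shows "\<exists>f :: 'a \<Rightarrow> 'a set. star_sum E t V x \<le> star_sum (\<lambda>u v. f u \<noteq> f v) t V x"
proof -
  let ?P = "\<lambda>E. star_sum E t V x" and ?Q = "\<lambda>E. star_sum E 1 V x"
  define \<G> where "\<G> = {E :: 'a \<Rightarrow> 'a \<Rightarrow> bool. symp E \<and> irreflp E}"
  define \<M> where "\<M> = {E\<in>\<G>. \<forall>E'\<in>\<G>. ?P E' \<le> ?P E}"
  define \<O> where "\<O> = {E\<in>\<M>. \<forall>E'\<in>\<M>. ?Q E' \<le> ?Q E}"
  have "E \<in> \<G>" using assms by (simp add: \<G>_def)
  then have "\<M> \<noteq> {}"
    using ex_greatest_star_sum[OF V, of E \<G> t x] by (auto simp: \<M>_def)
  then have "\<O> \<noteq> {}"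
    using ex_greatest_star_sum[OF V, of _ \<M> 1 x] by (auto simp: \<O>_def)
  then obtain M where M: "M \<in> \<O>" by blast
  \<comment> \<open>Cloning in both directions: the two changes have opposite signs, so maximality makes both
    vanish. This is applied to stars with \<open>t\<close> leaves and then, knowing that both clones lie in
    \<open>\<M>\<close>, to edges.\<close>
  have opt: "clone N u v \<in> \<O> \<and> link_sum N 1 V x u v = link_sum N 1 V x v u"
    if N: "N \<in> \<O>" and uv: "u \<in> V" "v \<in> V" "u \<noteq> v" "\<not> N u v" for N u v
  proof -
    have NG: "N \<in> \<G>" "N \<in> \<M>" using N by (auto simp: \<O>_def \<M>_def)
    then have vu: "\<not> N v u" using uv by (auto simp: \<G>_def dest: sympD)
    have G: "clone N u v \<in> \<G>" "clone N v u \<in> \<G>"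
      using NG by (auto simp: \<G>_def symp_clone irreflp_clone)
    have x0: "\<And>i. i \<in> V \<Longrightarrow> 0 \<le> x i" using x by (simp add: less_imp_le)
    note step = star_sum_clone[of V u v N x, OF V uv x0]
      star_sum_clone[of V v u N x, OF V uv(2,1) uv(3)[symmetric] vu x0]
    have balanced: "link_sum N s V x u v = link_sum N s V x v u \<and>
        star_sum (clone N u v) s V x = star_sum N s V x \<and> star_sum (clone N v u) s V x = star_sum N s V x"
      if max: "star_sum (clone N u v) s V x \<le> star_sum N s V x"
        "star_sum (clone N v u) s V x \<le> star_sum N s V x" for s
    proof -
      have "x v * (link_sum N s V x u v - link_sum N s V x v u) \<le> 0"
        "x u * (link_sum N s V x v u - link_sum N s V x u v) \<le> 0"
        using step[of s] max by auto
      then have "link_sum N s V x u v = link_sum N s V x v u"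
        using x[OF uv(1)] x[OF uv(2)] by (auto simp: mult_le_0_iff)
      then show ?thesis using step[of s] max by simp
    qed
    have max_t: "?P E' \<le> ?P N" if "E' \<in> \<G>" for E'
      using NG that by (auto simp: \<M>_def)
    then have M': "clone N u v \<in> \<M>" "clone N v u \<in> \<M>"
      using balanced[of t] G by (simp_all add: \<M>_def)
    have max_1: "?Q E' \<le> ?Q N" if "E' \<in> \<M>" for E'
      using N that by (auto simp: \<O>_def)
    have "link_sum N 1 V x u v = link_sum N 1 V x v u \<and> ?Q (clone N u v) = ?Q N"
      using balanced max_1 M' by blast
    then show ?thesis
      using M'(1) max_1 by (auto simp: \<O>_def)
  qed
  have deg: "(\<Sum>a | a \<in> V - {u, v} \<and> N u a. x a) = (\<Sum>a | a \<in> V - {u, v} \<and> N v a. x a)"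
    if "N \<in> \<O>" "u \<in> V" "v \<in> V" "u \<noteq> v" "\<not> N u v" for N u v
  proof -
    have "N \<in> \<G>" using that by (auto simp: \<O>_def \<M>_def)
    then have sym: "N a b \<longleftrightarrow> N b a" and irr: "\<not> N a a" for a b
      by (auto simp: \<G>_def dest: sympD irreflpD)
    show ?thesis
      using opt[OF that] link_sum_edge[of V N x u v, OF V sym irr]
        link_sum_edge[of V N x v u, OF V sym irr] by (simp add: insert_commute)
  qed
  have "M \<in> \<G>" using M by (auto simp: \<O>_def \<M>_def)
  then have sym: "M a b \<longleftrightarrow> M b a" and irr: "\<not> M a a" for a b
    by (auto simp: \<G>_def dest: sympD irreflpD)
  have trans: "\<not> M u w" if V3: "u \<in> V" "v \<in> V" "w \<in> V" and "\<not> M u v" "\<not> M v w" for u v w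
  proof
    assume "M u w"
    with that sym irr have ne: "u \<noteq> v" "u \<noteq> w" "v \<noteq> w" by metis+
    \<comment> \<open>In \<open>N\<close> the vertex \<open>w\<close> has lost its neighbour \<open>u\<close>, whereas \<open>v\<close> has kept all of its
      neighbours, yet their weighted degrees agree in both graphs.\<close>
    define N where "N = clone M v u"
    have N: "N \<in> \<O>" unfolding N_def using opt[OF M] V3 ne that sym by blast
    have Nv: "N v a \<longleftrightarrow> M v a" for a
      using ne that sym irr by (auto simp: N_def clone_def)
    have Nw: "N w a \<longleftrightarrow> M w a \<and> a \<noteq> u" for a
      using ne that sym by (auto simp: N_def clone_def)
    let ?D = "{a. a \<in> V - {v, w} \<and> M w a}"
    have "(\<Sum>a\<in>?D. x a) = (\<Sum>a | a \<in> V - {v, w} \<and> M v a. x a)"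
      using deg[OF M, of v w] V3 ne that by simp
    also have "\<dots> = (\<Sum>a | a \<in> V - {v, w} \<and> N w a. x a)"
      using deg[OF N, of v w] V3 ne that by (simp add: Nv)
    also have "{a. a \<in> V - {v, w} \<and> N w a} = ?D - {u}"
      using Nw by auto
    also have "(\<Sum>a\<in>?D - {u}. x a) = (\<Sum>a\<in>?D. x a) - x u"
      using V V3 ne \<open>M u w\<close> sym by (subst sum_diff1) auto
    finally show False using x[OF V3(1)] by simp
  qed
  define f where "f u = {w\<in>V. \<not> M u w}" for u
  have "M u v \<longleftrightarrow> f u \<noteq> f v" if "u \<in> V" "v \<in> V" for u v
  proof
    show "f u \<noteq> f v" if "M u v"
      using that \<open>v \<in> V\<close> irr by (auto simp: f_def)
    show "M u v" if "f u \<noteq> f v"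
    proof (rule ccontr)
      assume "\<not> M u v"
      then have "f u = f v" using trans sym \<open>u \<in> V\<close> \<open>v \<in> V\<close> unfolding f_def by blast
      with that show False by simp
    qed
  qed
  then have "?P M = star_sum (\<lambda>u v. f u \<noteq> f v) t V x" by (rule star_sum_cong)
  moreover have "?P E \<le> ?P M" using M \<open>E \<in> \<G>\<close> by (auto simp: \<O>_def \<M>_def)
  ultimately show ?thesis by auto
qed


section \<open>Merging parts\<close>

definition esym :: "nat \<Rightarrow> 'a set \<Rightarrow> ('a \<Rightarrow> real) \<Rightarrow> real" where
  "esym t A x = (\<Sum>T | T \<subseteq> A \<and> card T = t. \<Prod>i\<in>T. x i)"

lemma esym_nonneg:
  assumes "\<And>i. i \<in> A \<Longrightarrow> 0 \<le> x i"
  shows "0 \<le> esym t A x"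
  unfolding esym_def using assms by (intro sum_nonneg prod_nonneg) auto

text \<open>
  Each \<open>Suc m\<close>-subset arises in \<open>Suc m\<close> ways by adding a point to an \<open>m\<close>-subset; the right-hand
  side also counts the pairs in which the added point was already present.
\<close>

lemma esym_Suc_le:
  assumes A: "finite A" and x: "\<And>i. i \<in> A \<Longrightarrow> 0 \<le> x i"
  shows "Suc m * esym (Suc m) A x \<le> sum x A * esym m A x"
proof -
  let ?C = "\<lambda>m. {T. T \<subseteq> A \<and> card T = m}"
  let ?I = "SIGMA T:?C (Suc m). T"
  have fin: "finite T" if "T \<subseteq> A" for T using A that by (rule finite_subset[rotated])
  have "Suc m * esym (Suc m) A x = (\<Sum>T\<in>?C (Suc m). \<Sum>a\<in>T. \<Prod>i\<in>T. x i)"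
    by (simp add: esym_def sum_distrib_left)
  also have "\<dots> = (\<Sum>(T, a)\<in>?I. \<Prod>i\<in>T. x i)"
    using A fin by (intro sum.Sigma) auto
  also have "\<dots> = (\<Sum>(T, a)\<in>?I. x a * (\<Prod>i\<in>T - {a}. x i))"
    using fin by (intro sum.cong refl) (auto simp: prod.remove)
  also have "\<dots> = (\<Sum>(a, R)\<in>(\<lambda>(T, a). (a, T - {a})) ` ?I. x a * (\<Prod>i\<in>R. x i))"
    by (subst sum.reindex) (auto simp: inj_on_def case_prod_beta)
  also have "\<dots> \<le> (\<Sum>(a, R)\<in>A \<times> ?C m. x a * (\<Prod>i\<in>R. x i))"
    using A x fin by (intro sum_mono2) (auto intro!: mult_nonneg_nonneg prod_nonneg)
  also have "\<dots> = sum x A * esym m A x"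
    by (simp add: esym_def sum_product sum.cartesian_product)
  finally show ?thesis .
qed

text \<open>
  This is the exchange inequality for merging two parts \<open>A\<close> and \<open>B\<close> when the rest of the graph has
  weight \<open>r\<close>.  Merging loses the stars with centre in one of them and leaves in the other, worth
  \<open>esym t A x * sum x B + esym t B x * sum x A\<close>, and gains \<open>r\<close> times the weight \<open>mixed\<close> of the
  \<open>t\<close>-sets that meet both.  As \<open>mixed\<close> is at least \<open>esym (t - 1) A x * sum x B\<close>, the first summand
  of the loss is at most \<open>sum x A * mixed / t\<close>, which is at most half the gain because \<open>2 \<le> t\<close> and
  \<open>sum x A \<le> r\<close>; the second is treated in the same way.
\<close>

lemma esym_merge:
  assumes fin: "finite A" "finite B" and disj: "A \<inter> B = {}"
    and x: "\<And>i. i \<in> A \<union> B \<Longrightarrow> 0 \<le> x i"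
    and t: "2 \<le> t" and r: "sum x A \<le> r" "sum x B \<le> r"
  shows "esym t A x * (r + sum x B) + esym t B x * (r + sum x A) \<le> esym t (A \<union> B) x * r"
proof -
  obtain m where m: "t = Suc m" "1 \<le> m" using t by (cases t) auto
  let ?M = "\<lambda>A B. {T. T \<subseteq> A \<union> B \<and> card T = t \<and> T \<inter> A \<noteq> {} \<and> T \<inter> B \<noteq> {}}"
  define mixed where "mixed = (\<Sum>T\<in>?M A B. \<Prod>i\<in>T. x i)"
  have split: "esym t (A \<union> B) x = esym t A x + esym t B x + mixed"
  proof -
    let ?C = "\<lambda>A. {T. T \<subseteq> A \<and> card T = t}"
    have U: "?C (A \<union> B) = (?C A \<union> ?C B) \<union> ?M A B" by auto
    have "?C A \<inter> ?C B = {}"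
    proof -
      have False if "T \<in> ?C A \<inter> ?C B" for T
      proof -
        have "T = {}" using that disj by blast
        then show False using that t by simp
      qed
      then show ?thesis by blast
    qed
    moreover have "(?C A \<union> ?C B) \<inter> ?M A B = {}" using disj by auto
    moreover have "finite (?C A)" "finite (?C B)" "finite (?M A B)" using fin by auto
    ultimately show ?thesis
      unfolding esym_def mixed_def U
      by (subst sum.union_disjoint; (simp; fail)?)+
  qed
  have mixed_ge: "esym m A x * sum x B \<le> mixed" "esym m B x * sum x A \<le> mixed"
  proof -
    have *: "esym m A x * sum x B \<le> (\<Sum>T\<in>?M A B. \<Prod>i\<in>T. x i)"
      if AB: "finite A" "finite B" "A \<inter> B = {}" "\<And>i. i \<in> A \<union> B \<Longrightarrow> 0 \<le> x i" for A B
    proof -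
      let ?C = "{T. T \<subseteq> A \<and> card T = m}"
      let ?h = "\<lambda>(T, b). insert b T"
      have fin: "finite T" if "T \<subseteq> A" for T using AB(1) that by (rule finite_subset[rotated])
      have b: "b \<notin> T" if "T \<subseteq> A" "b \<in> B" for T b using that AB(3) by auto
      have inj: "inj_on ?h (?C \<times> B)"
      proof (rule inj_onI, clarify)
        fix T b T' b' assume "T \<subseteq> A" "b \<in> B" "T' \<subseteq> A" "b' \<in> B" and eq: "insert b T = insert b' T'"
        then have parts: "insert b T \<inter> A = T" "insert b' T' \<inter> A = T'"
            "insert b T \<inter> B = {b}" "insert b' T' \<inter> B = {b'}"
          using AB(3) by auto
        have "T = T'" using arg_cong[OF eq, of "\<lambda>S. S \<inter> A"] by (simp only: parts)
        moreover have "{b} = {b'}" using arg_cong[OF eq, of "\<lambda>S. S \<inter> B"] by (simp only: parts)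
        ultimately show "T = T' \<and> b = b'" by simp
      qed
      have "esym m A x * sum x B = (\<Sum>(T, b)\<in>?C \<times> B. (\<Prod>i\<in>T. x i) * x b)"
        by (simp add: esym_def sum_product sum.cartesian_product)
      also have "\<dots> = (\<Sum>p\<in>?C \<times> B. \<Prod>i\<in>?h p. x i)"
        using fin b by (intro sum.cong refl) auto
      also have "\<dots> = (\<Sum>T\<in>?h ` (?C \<times> B). \<Prod>i\<in>T. x i)"
        using sum.reindex[OF inj, of "prod x"] by simp
      also have "\<dots> \<le> (\<Sum>T\<in>?M A B. \<Prod>i\<in>T. x i)"
      proof (rule sum_mono2)
        show "?h ` (?C \<times> B) \<subseteq> ?M A B"
        proof clarify
          fix T b assume T: "T \<subseteq> A" "m = card T" "b \<in> B"
          then have "T \<noteq> {}" using m(2) by auto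
          with T show "insert b T \<subseteq> A \<union> B \<and> card (insert b T) = t \<and> insert b T \<inter> A \<noteq> {} \<and> insert b T \<inter> B \<noteq> {}"
            using fin b m(1) by auto
        qed
        show "0 \<le> prod x T" if "T \<in> ?M A B - ?h ` (?C \<times> B)" for T
          using that AB(4) by (intro prod_nonneg) auto
      qed (use AB in auto)
      finally show ?thesis .
    qed
    show "esym m A x * sum x B \<le> mixed"
      unfolding mixed_def using fin disj x by (intro *) auto
    have swap: "?M A B = ?M B A" by auto
    show "esym m B x * sum x A \<le> mixed"
      unfolding mixed_def swap using fin disj x by (intro *) auto
  qed
  have loss: "2 * (esym t C x * sum x D) \<le> r * mixed"
    if C: "finite C" "\<And>i. i \<in> C \<union> D \<Longrightarrow> 0 \<le> x i" "sum x C \<le> r" and CD: "esym m C x * sum x D \<le> mixed"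
    for C D
  proof -
    have nonneg: "0 \<le> esym t C x" "0 \<le> esym m C x" "0 \<le> sum x C" "0 \<le> sum x D"
      using C by (auto intro!: esym_nonneg sum_nonneg)
    have "2 * (esym t C x * sum x D) \<le> Suc m * esym t C x * sum x D"
      using nonneg m(2) by (simp add: mult.assoc mult_right_mono)
    also have "\<dots> \<le> sum x C * esym m C x * sum x D"
      using esym_Suc_le[of C x m] C nonneg by (intro mult_right_mono) (auto simp: m(1))
    also have "\<dots> \<le> r * (esym m C x * sum x D)"
      using C nonneg by (simp add: mult.assoc mult_right_mono)
    also have "\<dots> \<le> r * mixed"
      using CD C nonneg by (intro mult_left_mono) auto
    finally show ?thesis .
  qed
  have "2 * (esym t A x * sum x B) \<le> r * mixed" "2 * (esym t B x * sum x A) \<le> r * mixed"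
    using loss[of A B] loss[of B A] fin x r mixed_ge by auto
  then show ?thesis
    unfolding split by (simp add: algebra_simps)
qed

text \<open>
  In a complete multipartite graph the leaves of a star lie in one part and the centre lies outside
  of it.  With at least two leaves, the part of the leaves, and hence the centre, is determined by
  the vertex set of the star.
\<close>

lemma star_sum_multipartite:
  assumes V: "finite V" and t: "2 \<le> t"
  shows "star_sum (\<lambda>u v. f u \<noteq> f v) t V x =
    (\<Sum>k\<in>f ` V. esym t {v\<in>V. f v = k} x * sum x {v\<in>V. f v \<noteq> k})"
proof -
  let ?C = "\<lambda>k. {T. T \<subseteq> {v\<in>V. f v = k} \<and> card T = t}" and ?N = "\<lambda>k. {v\<in>V. f v \<noteq> k}"
  let ?I = "SIGMA k:f ` V. ?C k \<times> ?N k"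
  let ?h = "\<lambda>(k, T, c). insert c T"
  have fin: "finite T" if "T \<subseteq> V" for T using V that by (rule finite_subset[rotated])
  have "bij_betw ?h ?I {S. S \<subseteq> V \<and> induces_star (\<lambda>u v. f u \<noteq> f v) t S}"
    unfolding bij_betw_def
  proof (intro conjI inj_onI equalityI subsetI)
    fix p q assume pq: "p \<in> ?I" "q \<in> ?I" "?h p = ?h q"
    obtain k T c where p: "p = (k, T, c)" by (cases p)
    obtain l U d where q: "q = (l, U, d)" by (cases q)
    have T: "T \<subseteq> {v\<in>V. f v = k}" "card T = t" "f c \<noteq> k" and U: "U \<subseteq> {v\<in>V. f v = l}" "card U = t" "f d \<noteq> l"
      and eq: "insert c T = insert d U"
      using pq by (auto simp: p q)
    have "k = l"
    proof (rule ccontr)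
      assume "k \<noteq> l"
      then have "T \<subseteq> {d}" using T U eq by auto
      then have "card T \<le> 1" using card_mono[of "{d}" T] by simp
      with T t show False by simp
    qed
    have parts: "insert c T \<inter> {v. f v = k} = T" "insert d U \<inter> {v. f v = k} = U"
      "insert c T \<inter> {v. f v \<noteq> k} = {c}" "insert d U \<inter> {v. f v \<noteq> k} = {d}"
      using T U \<open>k = l\<close> by auto
    have "T = U" using arg_cong[OF eq, of "\<lambda>S. S \<inter> {v. f v = k}"] by (simp only: parts)
    moreover have "{c} = {d}"
      using arg_cong[OF eq, of "\<lambda>S. S \<inter> {v. f v \<noteq> k}"] by (simp only: parts)
    ultimately show "p = q" unfolding p q using \<open>k = l\<close> by simp
  next
    fix S assume "S \<in> ?h ` ?I"
    then obtain k T c where S: "S = insert c T" "T \<subseteq> {v\<in>V. f v = k}" "card T = t" "c \<in> V" "f c \<noteq> k"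
      by auto
    then have "finite T" "c \<notin> T" using fin by auto
    then show "S \<in> {S. S \<subseteq> V \<and> induces_star (\<lambda>u v. f u \<noteq> f v) t S}"
      using S by (auto simp: induces_star_def)
  next
    fix S assume "S \<in> {S. S \<subseteq> V \<and> induces_star (\<lambda>u v. f u \<noteq> f v) t S}"
    then obtain c where S: "S \<subseteq> V" "card S = Suc t" "c \<in> S"
      and star: "\<forall>u\<in>S. \<forall>v\<in>S. f u \<noteq> f v \<longleftrightarrow> (u = c) \<noteq> (v = c)"
      by (auto simp: induces_star_def)
    have card: "card (S - {c}) = t" using S by (simp add: card_Diff_singleton)
    then obtain w where w: "w \<in> S - {c}" using t by (metis all_not_in_conv card.empty not_numeral_le_zero)
    have "(f w, S - {c}, c) \<in> ?I" using S star w card by auto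
    then show "S \<in> ?h ` ?I" by (rule rev_image_eqI) (use S in auto)
  qed
  then have "star_sum (\<lambda>u v. f u \<noteq> f v) t V x = (\<Sum>p\<in>?I. \<Prod>i\<in>?h p. x i)"
    unfolding star_sum_def by (rule sum.reindex_bij_betw[symmetric])
  also have "\<dots> = (\<Sum>(k, T, c)\<in>?I. (\<Prod>i\<in>T. x i) * x c)"
  proof (intro sum.cong refl)
    fix p assume "p \<in> ?I"
    then obtain k T c where "p = (k, T, c)" "T \<subseteq> V" "c \<notin> T" by auto
    then show "(\<Prod>i\<in>?h p. x i) = (case p of (k, T, c) \<Rightarrow> (\<Prod>i\<in>T. x i) * x c)"
      using fin by simp
  qed
  also have "\<dots> = (\<Sum>k\<in>f ` V. \<Sum>(T, c)\<in>?C k \<times> ?N k. (\<Prod>i\<in>T. x i) * x c)"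
    using V by (intro sum.Sigma[symmetric]) auto
  also have "\<dots> = (\<Sum>k\<in>f ` V. esym t {v\<in>V. f v = k} x * sum x {v\<in>V. f v \<noteq> k})"
    by (simp add: esym_def sum_product sum.cartesian_product)
  finally show ?thesis .
qed

text \<open>
  The merged parts \<open>i\<close> and \<open>j\<close> are chosen different from a heaviest part \<open>k\<close>: then the weight
  outside of them is at least that of \<open>k\<close>, which is the hypothesis of \<open>esym_merge\<close>.
\<close>

lemma merge_parts:
  fixes f :: "'a \<Rightarrow> 'b"
  assumes V: "finite V" and x: "\<And>i. i \<in> V \<Longrightarrow> 0 \<le> x i" and t: "2 \<le> t"
    and parts: "3 \<le> card (f ` V)"
  shows "\<exists>g :: 'a \<Rightarrow> 'b. card (g ` V) < card (f ` V) \<and>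
           star_sum (\<lambda>u v. f u \<noteq> f v) t V x \<le> star_sum (\<lambda>u v. g u \<noteq> g v) t V x"
proof -
  let ?K = "f ` V"
  define s where "s k = sum x {v\<in>V. f v = k}" for k
  have K: "finite ?K" "?K \<noteq> {}" using V parts by auto
  have "Max (s ` ?K) \<in> s ` ?K" using K by (intro Max_in) auto
  then obtain k where k: "k \<in> ?K" "Max (s ` ?K) = s k" by blast
  have k_max: "s l \<le> s k" if "l \<in> ?K" for l
    unfolding k(2)[symmetric] using K that by (intro Max_ge) auto
  have "2 \<le> card (?K - {k})" using parts k by (simp add: card_Diff_singleton)
  then obtain P where "P \<subseteq> ?K - {k}" "card P = 2" by (rule obtain_subset_with_card_n)
  then obtain i j where ij: "i \<in> ?K" "j \<in> ?K" "i \<noteq> j" "i \<noteq> k" "j \<noteq> k"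
    unfolding card_2_iff by blast
  define g where "g v = (if f v = j then i else f v)" for v
  have gV: "g ` V = ?K - {j}" using ij by (auto simp: g_def image_iff)
  define r where "r = sum x {v\<in>V. f v \<noteq> i \<and> f v \<noteq> j}"
  let ?T = "\<lambda>f k. esym t {v\<in>V. f v = k} x * sum x {v\<in>V. f v \<noteq> k}"
  have "s k \<le> r" unfolding s_def r_def using V x ij by (intro sum_mono2) auto
  then have sr: "s i \<le> r" "s j \<le> r"
    using k_max[OF ij(1)] k_max[OF ij(2)] by linarith+
  have other: "?T g l = ?T f l" if "l \<in> ?K - {i, j}" for l
  proof -
    have "g v = l \<longleftrightarrow> f v = l" for v using that by (auto simp: g_def)
    then show ?thesis by simp
  qed
  have i: "sum x {v\<in>V. f v \<noteq> i} = r + s j" "sum x {v\<in>V. f v \<noteq> j} = r + s i"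
    unfolding r_def s_def using V ij
    by (subst sum.union_disjoint[symmetric]; auto intro!: sum.cong)+
  have gi: "{v\<in>V. g v = i} = {v\<in>V. f v = i} \<union> {v\<in>V. f v = j}" "{v\<in>V. g v \<noteq> i} = {v\<in>V. f v \<noteq> i \<and> f v \<noteq> j}"
    using ij by (auto simp: g_def)
  have "?T f i + ?T f j \<le> ?T g i"
    unfolding i gi r_def[symmetric] unfolding s_def
    using V x t sr ij by (intro esym_merge) (auto simp: s_def)
  moreover have "(\<Sum>l\<in>?K. ?T f l) = (\<Sum>l\<in>?K - {i, j}. ?T f l) + (?T f i + ?T f j)"
    using K ij by (subst sum.subset_diff[of "{i, j}"]) auto
  moreover have "(\<Sum>l\<in>?K - {j}. ?T g l) = (\<Sum>l\<in>?K - {i, j}. ?T f l) + ?T g i"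
  proof -
    have "(\<Sum>l\<in>?K - {j}. ?T g l) = ?T g i + (\<Sum>l\<in>?K - {j} - {i}. ?T g l)"
      using K ij by (intro sum.remove) auto
    also have "?K - {j} - {i} = ?K - {i, j}" by auto
    finally show ?thesis using other by simp
  qed
  ultimately have "star_sum (\<lambda>u v. f u \<noteq> f v) t V x \<le> star_sum (\<lambda>u v. g u \<noteq> g v) t V x"
    unfolding star_sum_multipartite[OF V t] gV by linarith
  moreover have "card (g ` V) < card ?K"
    unfolding gV using K ij by (intro psubset_card_mono) auto
  ultimately show ?thesis by blast
qed

lemma multipartite_le_bipartite:
  fixes f :: "'a \<Rightarrow> 'b"
  assumes V: "finite V" and x: "\<And>i. i \<in> V \<Longrightarrow> 0 \<le> x i" and t: "2 \<le> t"
  shows "\<exists>B. star_sum (\<lambda>u v. f u \<noteq> f v) t V x \<le> star_sum (\<lambda>u v. (u \<in> B) \<noteq> (v \<in> B)) t V x"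
proof (induction "card (f ` V)" arbitrary: f rule: less_induct)
  case less
  show ?case
  proof (cases "3 \<le> card (f ` V)")
    case True
    obtain g :: "'a \<Rightarrow> 'b" where g: "card (g ` V) < card (f ` V)"
      "star_sum (\<lambda>u v. f u \<noteq> f v) t V x \<le> star_sum (\<lambda>u v. g u \<noteq> g v) t V x"
      using merge_parts[of V x t f, OF V x t True] by blast
    from less[OF g(1)] obtain B where
      "star_sum (\<lambda>u v. g u \<noteq> g v) t V x \<le> star_sum (\<lambda>u v. (u \<in> B) \<noteq> (v \<in> B)) t V x" ..
    then show ?thesis using order_trans[OF g(2)] by blast
  next
    case False
    then have "card (f ` V) = 0 \<or> card (f ` V) = Suc 0 \<or> card (f ` V) = 2" by auto
    then obtain a b where "f ` V \<subseteq> {a, b}"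
      unfolding card_1_singleton_iff card_2_iff using V card_0_eq[of "f ` V"] by blast
    then have "f u \<noteq> f v \<longleftrightarrow> (u \<in> {v. f v = a}) \<noteq> (v \<in> {v. f v = a})" if "u \<in> V" "v \<in> V" for u v
      using that by auto
    then have "star_sum (\<lambda>u v. f u \<noteq> f v) t V x =
        star_sum (\<lambda>u v. (u \<in> {v. f v = a}) \<noteq> (v \<in> {v. f v = a})) t V x"
      by (rule star_sum_cong)
    then show ?thesis by (metis order_refl)
  qed
qed

text \<open>
  Both steps are carried out on the vertices of positive weight; the bipartition so found serves for
  the whole graph, as the other vertices contribute to neither side.
\<close>

theorem star_sum_le_bipartite:
  assumes V: "finite V" and x: "\<And>i. i \<in> V \<Longrightarrow> 0 \<le> x i" and E: "symp E" "irreflp E" and t: "2 \<le> t"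
  shows "\<exists>B. star_sum E t V x \<le> star_sum (\<lambda>u v. (u \<in> B) \<noteq> (v \<in> B)) t V x"
proof -
  let ?W = "{v\<in>V. x v \<noteq> 0}"
  have W: "finite ?W" "\<And>i. i \<in> ?W \<Longrightarrow> 0 < x i" using V x by (auto simp: order_less_le)
  obtain f :: "'a \<Rightarrow> 'a set" where f: "star_sum E t ?W x \<le> star_sum (\<lambda>u v. f u \<noteq> f v) t ?W x"
    using star_sum_le_multipartite[of ?W x E t, OF W E] by blast
  obtain B where B: "star_sum (\<lambda>u v. f u \<noteq> f v) t ?W x \<le> star_sum (\<lambda>u v. (u \<in> B) \<noteq> (v \<in> B)) t ?W x"
    using multipartite_le_bipartite[of ?W x t f, OF W(1) less_imp_le[OF W(2)] t] by blast
  show ?thesis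
    using order_trans[OF f B] unfolding star_sum_support[OF V] ..
qed


section \<open>From weighted counts to the spectral parameters\<close>

text \<open>
  Digraph isomorphisms carry separate maps on arcs and on their ends.  When arcs are pairs, these are
  determined by the map on vertices.
\<close>

lemma digraph_iso_induced_iff:
  assumes "pair_wf_digraph F"
  shows "digraph_iso (with_proj G \<restriction> S) (with_proj F) \<longleftrightarrow>
    (\<exists>f. bij_betw f S (pverts F) \<and>
         (\<forall>u\<in>S. \<forall>v\<in>S. (u, v) \<in> parcs G \<longleftrightarrow> (f u, f v) \<in> parcs F))"
    (is "?L \<longleftrightarrow> ?R")
proof
  let ?A = "{e \<in> parcs G. fst e \<in> S \<and> snd e \<in> S}"
  assume ?L
  then obtain h where h: "pre_digraph.digraph_isomorphism (with_proj G \<restriction> S) h"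
    and F: "with_proj F = app_iso h (with_proj G \<restriction> S)"
    by (auto simp: digraph_iso_def)
  let ?f = "iso_verts h"
  have F': "pverts F = ?f ` S" "parcs F = iso_arcs h ` ?A" "iso_tail h = fst" "iso_head h = snd"
    using arg_cong[OF F, of verts] arg_cong[OF F, of arcs] arg_cong[OF F, of tail] arg_cong[OF F, of head]
    by simp_all
  have inj: "inj_on ?f S"
    and ends: "\<forall>e\<in>?A. ?f (fst e) = fst (iso_arcs h e) \<and> ?f (snd e) = snd (iso_arcs h e)"
    using h by (simp_all add: pre_digraph.digraph_isomorphism_def F'(3,4))
  have arcs: "iso_arcs h e = (?f (fst e), ?f (snd e))" if "e \<in> ?A" for e
    using bspec[OF ends that] by (simp add: prod_eq_iff)
  have "parcs F = (\<lambda>e. (?f (fst e), ?f (snd e))) ` ?A"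
    unfolding F'(2) using arcs by (rule image_cong[OF refl])
  moreover have "(u, v) \<in> parcs G \<longleftrightarrow> (?f u, ?f v) \<in> (\<lambda>e. (?f (fst e), ?f (snd e))) ` ?A"
    if "u \<in> S" "v \<in> S" for u v
  proof
    assume "(u, v) \<in> parcs G"
    with that show "(?f u, ?f v) \<in> (\<lambda>e. (?f (fst e), ?f (snd e))) ` ?A"
      by (intro image_eqI[of _ _ "(u, v)"]) auto
  next
    assume "(?f u, ?f v) \<in> (\<lambda>e. (?f (fst e), ?f (snd e))) ` ?A"
    then obtain a b where "(a, b) \<in> parcs G" "a \<in> S" "b \<in> S" "?f u = ?f a" "?f v = ?f b" by auto
    with that inj show "(u, v) \<in> parcs G" by (simp add: inj_on_eq_iff)
  qed
  ultimately have "\<forall>u\<in>S. \<forall>v\<in>S. (u, v) \<in> parcs G \<longleftrightarrow> (?f u, ?f v) \<in> parcs F"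
    by simp
  with inj F'(1) show ?R by (auto simp: bij_betw_def)
next
  let ?A = "{e \<in> parcs G. fst e \<in> S \<and> snd e \<in> S}"
  assume ?R
  then obtain f where f: "inj_on f S" "f ` S = pverts F"
    and E: "\<And>u v. u \<in> S \<Longrightarrow> v \<in> S \<Longrightarrow> (u, v) \<in> parcs G \<longleftrightarrow> (f u, f v) \<in> parcs F"
    by (auto simp: bij_betw_def)
  let ?h = "\<lparr>iso_verts = f, iso_arcs = map_prod f f, iso_head = snd, iso_tail = fst\<rparr>"
  have "parcs F = map_prod f f ` ?A"
  proof (intro equalityI subsetI)
    fix e assume e: "e \<in> parcs F"
    then have "fst e \<in> f ` S" "snd e \<in> f ` S"
      using pair_wf_digraph.arc_fst_in_verts[OF assms] pair_wf_digraph.arc_snd_in_verts[OF assms]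
      by (simp_all add: f(2))
    then obtain u v where "u \<in> S" "v \<in> S" "e = (f u, f v)" by (metis imageE prod.collapse)
    with e E show "e \<in> map_prod f f ` ?A" by (intro image_eqI[of _ _ "(u, v)"]) auto
  qed (use E in auto)
  then have "with_proj F = app_iso ?h (with_proj G \<restriction> S)"
    by (simp add: with_proj_def app_iso_def induce_subgraph_def f(2))
  moreover have "pre_digraph.digraph_isomorphism (with_proj G \<restriction> S) ?h"
    using f(1) unfolding pre_digraph.digraph_isomorphism_def
    by (auto simp: wf_digraph_def inj_on_def)
  ultimately show ?L by (auto simp: digraph_iso_def)
qed

lemma pair_graph_complete_multipartite: "pair_graph (complete_multipartite ns)"
proof -
  have "pverts (complete_multipartite ns) = (SIGMA p:{..<length ns}. {..<ns ! p})"
    by (auto simp: complete_multipartite_def Let_def)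
  then have fin: "finite (pverts (complete_multipartite ns))" by simp
  moreover have "finite (parcs (complete_multipartite ns))"
    by (rule finite_subset[of _ "pverts (complete_multipartite ns) \<times> pverts (complete_multipartite ns)"])
      (use fin in \<open>auto simp: complete_multipartite_def Let_def\<close>)
  ultimately show ?thesis
    by unfold_locales (auto simp: complete_multipartite_def Let_def symmetric_def sym_def)
qed

lemma in_parcs_complete_multipartite:
  "(u, v) \<in> parcs (complete_multipartite ns) \<longleftrightarrow>
     u \<in> pverts (complete_multipartite ns) \<and> v \<in> pverts (complete_multipartite ns) \<and> fst u \<noteq> fst v"
  by (auto simp: complete_multipartite_def Let_def)

lemma pverts_complete_bipartite:
  "pverts (complete_multipartite [m, n]) = {0} \<times> {..<m} \<union> {1} \<times> {..<n}"
  by (auto simp: complete_multipartite_def Let_def less_Suc_eq)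

lemma card_pverts_complete_bipartite: "card (pverts (complete_multipartite [m, n])) = m + n"
  unfolding pverts_complete_bipartite
  by (subst card_Un_disjoint) (auto simp: card_cartesian_product)

abbreviation adjacent :: "'a pair_pre_digraph \<Rightarrow> 'a \<Rightarrow> 'a \<Rightarrow> bool" where
  "adjacent G u v \<equiv> (u, v) \<in> parcs G"

lemma induced_copies_star:
  "induced_copies (complete_multipartite [1, t]) G =
     {S. S \<subseteq> pverts G \<and> induces_star (adjacent G) t S}"
proof -
  let ?F = "complete_multipartite [1, t]"
  have V: "pverts ?F = insert (0, 0) ({1} \<times> {..<t})"
    unfolding pverts_complete_bipartite by auto
  have adj: "adjacent ?F u v \<longleftrightarrow> (u = (0, 0)) \<noteq> (v = (0, 0))" if "u \<in> pverts ?F" "v \<in> pverts ?F" for u v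
    using that unfolding in_parcs_complete_multipartite unfolding V by auto
  have "digraph_iso (with_proj G \<restriction> S) (with_proj ?F) \<longleftrightarrow> induces_star (adjacent G) t S" for S
  proof -
    have wf: "pair_wf_digraph ?F"
      using pair_graph_complete_multipartite[of "[1, t]"]
      by (simp add: pair_graph_def pair_digraph_def pair_fin_digraph_def)
    show ?thesis
      unfolding digraph_iso_induced_iff[OF wf]
    proof
      assume "\<exists>f. bij_betw f S (pverts ?F) \<and> (\<forall>u\<in>S. \<forall>v\<in>S. adjacent G u v \<longleftrightarrow> adjacent ?F (f u) (f v))"
      then obtain f where f: "bij_betw f S (pverts ?F)"
        and E: "\<forall>u\<in>S. \<forall>v\<in>S. adjacent G u v \<longleftrightarrow> adjacent ?F (f u) (f v)" by blast
      have card: "card S = Suc t"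
        using bij_betw_same_card[OF f] card_pverts_complete_bipartite[of 1 t] by simp
      have "(0, 0) \<in> f ` S" using f unfolding bij_betw_def V by simp
      then obtain c where c: "c \<in> S" "f c = (0, 0)" by auto
      have "f u = (0, 0) \<longleftrightarrow> u = c" if "u \<in> S" for u
        using f c that by (metis bij_betw_def inj_onD)
      moreover have "f u \<in> pverts ?F" if "u \<in> S" for u
        using f that by (auto simp: bij_betw_def)
      ultimately show "induces_star (adjacent G) t S"
        unfolding induces_star_def using card c E adj by (intro conjI bexI[of _ c]) auto
    next
      assume "induces_star (adjacent G) t S"
      then obtain c where S: "card S = Suc t" "c \<in> S"
        and E: "\<forall>u\<in>S. \<forall>v\<in>S. adjacent G u v \<longleftrightarrow> (u = c) \<noteq> (v = c)"
        by (auto simp: induces_star_def)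
      then have "finite (S - {c})" "card (S - {c}) = card ({1 :: nat} \<times> {..<t})"
        by (auto simp: card_cartesian_product intro: card_ge_0_finite)
      then obtain g where g: "bij_betw g (S - {c}) ({1 :: nat} \<times> {..<t})"
        by (metis finite_same_card_bij finite_cartesian_product finite.emptyI finite.insertI finite_lessThan)
      define f where "f = g(c := (0, 0))"
      have "bij_betw f (S - {c}) ({1} \<times> {..<t})"
        using g by (rule bij_betw_cong[THEN iffD1, rotated]) (auto simp: f_def)
      then have "bij_betw f ((S - {c}) \<union> {c}) ({1} \<times> {..<t} \<union> {(0, 0)})"
        by (rule bij_betw_combine) (auto simp: f_def bij_betw_def)
      moreover have "(S - {c}) \<union> {c} = S" using S by auto
      ultimately have f: "bij_betw f S (pverts ?F)" unfolding V by simp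
      have "f u = (0, 0) \<longleftrightarrow> u = c" if "u \<in> S" for u
        using bspec[OF bij_betwE[OF g], of u] that by (cases "u = c") (auto simp: f_def)
      moreover have "f u \<in> pverts ?F" if "u \<in> S" for u
        using f that by (auto simp: bij_betw_def)
      ultimately show "\<exists>f. bij_betw f S (pverts ?F) \<and> (\<forall>u\<in>S. \<forall>v\<in>S. adjacent G u v \<longleftrightarrow> adjacent ?F (f u) (f v))"
        using f E adj by (intro exI[of _ f]) auto
    qed
  qed
  then show ?thesis by (simp add: induced_copies_def)
qed

lemma ind_poly_star:
  "ind_poly (complete_multipartite [1, t]) G x = fact (Suc t) * star_sum (adjacent G) t (pverts G) x"
  unfolding ind_poly_def star_sum_def induced_copies_star
  using card_pverts_complete_bipartite[of 1 t] by simp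

lemma lambda_ind_mono:
  assumes G: "finite (pverts G)" "pverts G \<noteq> {}" and H: "finite (pverts H)" "pverts H \<noteq> {}" and "1 \<le> \<alpha>"
    and le: "\<And>x. (\<Sum>i\<in>pverts G. \<bar>x i\<bar> powr \<alpha>) = 1 \<Longrightarrow>
      \<exists>y. (\<Sum>i\<in>pverts H. \<bar>y i\<bar> powr \<alpha>) = 1 \<and> ind_poly F G x \<le> ind_poly F H y"
  shows "lambda_ind \<alpha> F G \<le> lambda_ind \<alpha> F H"
  using lambda_ind_attained(1)[OF G \<open>1 \<le> \<alpha>\<close>, of F] lambda_ind_attained(2)[OF H \<open>1 \<le> \<alpha>\<close>, of F] le
  by fastforce

lemma lambda_ind_star_iso_le:
  assumes g: "bij_betw g (pverts H) (pverts G)"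
    and E: "\<And>u v. u \<in> pverts H \<Longrightarrow> v \<in> pverts H \<Longrightarrow> adjacent H u v \<longleftrightarrow> adjacent G (g u) (g v)"
    and H: "finite (pverts H)" "pverts H \<noteq> {}" and "1 \<le> \<alpha>"
  shows "lambda_ind \<alpha> (complete_multipartite [1, t]) G \<le> lambda_ind \<alpha> (complete_multipartite [1, t]) H"
proof (rule lambda_ind_mono)
  show "finite (pverts G)" "pverts G \<noteq> {}" using bij_betw_finite[OF g] g H by (auto simp: bij_betw_def)
  fix x :: "'b \<Rightarrow> real" assume "(\<Sum>i\<in>pverts G. \<bar>x i\<bar> powr \<alpha>) = 1"
  moreover have "(\<Sum>i\<in>pverts H. \<bar>x (g i)\<bar> powr \<alpha>) = (\<Sum>i\<in>pverts G. \<bar>x i\<bar> powr \<alpha>)"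
    by (rule sum.reindex_bij_betw[OF g])
  moreover have "ind_poly (complete_multipartite [1, t]) H (\<lambda>v. x (g v)) =
      ind_poly (complete_multipartite [1, t]) G x"
    unfolding ind_poly_star using star_sum_reindex[of g "pverts H" "pverts G" "adjacent H" "adjacent G" t x, OF g E] by simp
  ultimately show "\<exists>y. (\<Sum>i\<in>pverts H. \<bar>y i\<bar> powr \<alpha>) = 1 \<and>
      ind_poly (complete_multipartite [1, t]) G x \<le> ind_poly (complete_multipartite [1, t]) H y"
    by (intro exI[of _ "\<lambda>v. x (g v)"]) auto
qed (use H \<open>1 \<le> \<alpha>\<close> in auto)

text \<open>
  \<open>spec_ind\<close> ranges over graphs on natural numbers, whereas complete multipartite graphs have pairs as
  vertices.  This lemma lets the latter compete.
\<close>

lemma ex_nat_graph: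
  assumes G: "pair_graph G" "pverts G \<noteq> {}" and "1 \<le> \<alpha>"
  shows "\<exists>H :: nat pair_pre_digraph. pair_graph H \<and> card (pverts H) = card (pverts G) \<and>
    lambda_ind \<alpha> (complete_multipartite [1, t]) H = lambda_ind \<alpha> (complete_multipartite [1, t]) G"
proof -
  interpret pair_graph G by (rule G(1))
  obtain h :: "'a \<Rightarrow> nat" where h: "inj_on h (pverts G)"
    using finite_imp_inj_to_nat_seg[OF pair_finite_verts] by auto
  define H where "H = \<lparr>pverts = h ` pverts G, parcs = map_prod h h ` parcs G\<rparr>"
  have bij: "bij_betw h (pverts G) (pverts H)" using h by (simp add: bij_betw_def H_def)
  have E: "adjacent G u v \<longleftrightarrow> adjacent H (h u) (h v)" if "u \<in> pverts G" "v \<in> pverts G" for u v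
    using that h by (auto simp: H_def dest: inj_onD in_arcsD1 in_arcsD2)
  let ?g = "the_inv_into (pverts G) h"
  have bij': "bij_betw ?g (pverts H) (pverts G)" by (rule bij_betw_the_inv_into[OF bij])
  have E': "adjacent H u v \<longleftrightarrow> adjacent G (?g u) (?g v)" if "u \<in> pverts H" "v \<in> pverts H" for u v
  proof -
    have "?g u \<in> pverts G" "?g v \<in> pverts G" "h (?g u) = u" "h (?g v) = v"
      using that bij bij' f_the_inv_into_f_bij_betw[OF bij] by (auto simp: bij_betw_def)
    then show ?thesis using E by metis
  qed
  have H: "finite (pverts H)" "pverts H \<noteq> {}" using G by (auto simp: H_def)
  have "pair_graph H"
  proof
    show "symmetric (with_proj H)"
      using pair_sym_arcs by (force simp: symmetric_def sym_def H_def)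
    show "fst e \<noteq> snd e" if "e \<in> parcs H" for e
      using that h pair_no_loops by (fastforce simp: H_def dest: inj_onD in_arcsD1 in_arcsD2)
  qed (auto simp: H_def pair_finite_verts pair_finite_arcs dest: in_arcsD1 in_arcsD2)
  moreover have "card (pverts H) = card (pverts G)" using bij_betw_same_card[OF bij] by simp
  moreover have "lambda_ind \<alpha> (complete_multipartite [1, t]) H = lambda_ind \<alpha> (complete_multipartite [1, t]) G"
    using lambda_ind_star_iso_le[OF bij E pair_finite_verts G(2) \<open>1 \<le> \<alpha>\<close>]
      lambda_ind_star_iso_le[OF bij' E' H \<open>1 \<le> \<alpha>\<close>] by (intro antisym)
  ultimately show ?thesis by blast
qed

text \<open>
  The bipartition depends on the weighting, so it is taken for an optimal weighting of \<open>G\<close>, made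
  nonnegative; this weighting is then carried over to the bipartite graph.
\<close>

lemma lambda_ind_star_le_bipartite:
  assumes G: "pair_graph G" "pverts G \<noteq> {}" and "1 \<le> \<alpha>" and t: "2 \<le> t"
  shows "\<exists>n1 n2. n1 + n2 = card (pverts G) \<and>
    lambda_ind \<alpha> (complete_multipartite [1, t]) G
      \<le> lambda_ind \<alpha> (complete_multipartite [1, t]) (complete_multipartite [n1, n2])"
proof -
  interpret pair_graph G by (rule G(1))
  let ?S = "complete_multipartite [1, t]" and ?V = "pverts G"
  have sym: "symp (adjacent G)" and irr: "irreflp (adjacent G)"
    using pair_sym_arcs pair_no_loops by (force simp: symmetric_def sym_def symp_def irreflp_def)+
  obtain x where x: "(\<Sum>i\<in>?V. \<bar>x i\<bar> powr \<alpha>) = 1" "lambda_ind \<alpha> ?S G = ind_poly ?S G x"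
    using lambda_ind_attained(1)[OF pair_finite_verts G(2) \<open>1 \<le> \<alpha>\<close>, of ?S] by auto
  let ?x = "\<lambda>v. \<bar>x v\<bar>"
  obtain B where B: "star_sum (adjacent G) t ?V ?x \<le> star_sum (\<lambda>u v. (u \<in> B) \<noteq> (v \<in> B)) t ?V ?x"
    using star_sum_le_bipartite[of ?V ?x "adjacent G" t, OF pair_finite_verts _ sym irr t] by auto
  let ?n1 = "card (?V \<inter> B)" and ?n2 = "card (?V - B)"
  let ?K = "complete_multipartite [?n1, ?n2]"
  have n: "?n1 + ?n2 = card ?V"
    by (metis add.commute card_Diff_subset_Int card_Int_Diff pair_finite_verts)
  obtain g1 where g1: "bij_betw g1 ({0 :: nat} \<times> {..<?n1}) (?V \<inter> B)"
    using finite_same_card_bij[of "{0 :: nat} \<times> {..<?n1}" "?V \<inter> B"] pair_finite_verts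
    by (auto simp: card_cartesian_product)
  obtain g2 where g2: "bij_betw g2 ({1 :: nat} \<times> {..<?n2}) (?V - B)"
    using finite_same_card_bij[of "{1 :: nat} \<times> {..<?n2}" "?V - B"] pair_finite_verts
    by (auto simp: card_cartesian_product)
  define g where "g p = (if fst p = 0 then g1 p else g2 p)" for p :: "nat \<times> nat"
  have "bij_betw g ({0} \<times> {..<?n1}) (?V \<inter> B)" "bij_betw g ({1} \<times> {..<?n2}) (?V - B)"
    by (rule bij_betw_cong[THEN iffD1, rotated, OF g1] bij_betw_cong[THEN iffD1, rotated, OF g2];
        auto simp: g_def)+
  note parts = this
  have "bij_betw g ({0} \<times> {..<?n1} \<union> {1} \<times> {..<?n2}) ((?V \<inter> B) \<union> (?V - B))"
    by (rule bij_betw_combine[OF parts]) auto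
  moreover have "(?V \<inter> B) \<union> (?V - B) = ?V" by auto
  ultimately have g: "bij_betw g (pverts ?K) ?V"
    by (simp add: pverts_complete_bipartite)
  have gB: "g p \<in> B \<longleftrightarrow> fst p = 0" if "p \<in> pverts ?K" for p
    using that parts unfolding pverts_complete_bipartite bij_betw_def by auto
  have K: "finite (pverts ?K)" "pverts ?K \<noteq> {}"
    using pair_finite_verts G(2) bij_betw_finite[OF g] g by (auto simp: bij_betw_def)
  have E: "adjacent ?K p q \<longleftrightarrow> (g p \<in> B) \<noteq> (g q \<in> B)" if "p \<in> pverts ?K" "q \<in> pverts ?K" for p q
    using that gB unfolding in_parcs_complete_multipartite by (auto simp: pverts_complete_bipartite)
  have sum: "(\<Sum>i\<in>pverts ?K. \<bar>?x (g i)\<bar> powr \<alpha>) = 1"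
    using sum.reindex_bij_betw[OF g, of "\<lambda>v. \<bar>x v\<bar> powr \<alpha>"] x(1) by simp
  have "lambda_ind \<alpha> ?S G \<le> fact (Suc t) * star_sum (adjacent G) t ?V ?x"
    unfolding x(2) ind_poly_star using star_sum_le_abs by (intro mult_left_mono) auto
  also have "\<dots> \<le> fact (Suc t) * star_sum (\<lambda>u v. (u \<in> B) \<noteq> (v \<in> B)) t ?V ?x"
    using B by (intro mult_left_mono) auto
  also have "star_sum (\<lambda>u v. (u \<in> B) \<noteq> (v \<in> B)) t ?V ?x = star_sum (adjacent ?K) t (pverts ?K) (\<lambda>p. ?x (g p))"
    using star_sum_reindex[of g "pverts ?K" ?V "adjacent ?K" "\<lambda>u v. (u \<in> B) \<noteq> (v \<in> B)" t ?x, OF g E] by simp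
  also have "fact (Suc t) * \<dots> = ind_poly ?S ?K (\<lambda>p. ?x (g p))"
    by (rule ind_poly_star[symmetric])
  also have "\<dots> \<le> lambda_ind \<alpha> ?S ?K"
    using lambda_ind_attained(2)[OF K \<open>1 \<le> \<alpha>\<close>, of ?S] sum by auto
  finally show ?thesis using n by blast
qed

theorem theorem1p3:
  fixes t n :: nat and \<alpha> :: real
  assumes "t \<ge> 2" and "\<alpha> \<ge> 1" and "n \<ge> 1"
  shows "spec_ind \<alpha> (complete_multipartite [1, t]) n =
         Max {lambda_ind \<alpha> (complete_multipartite [1, t]) (complete_multipartite [n1, n2]) | n1 n2.
                n1 + n2 = n}"
proof -
  let ?S = "complete_multipartite [1, t]"
  let ?A = "{lambda_ind \<alpha> ?S (complete_multipartite [n1, n2]) | n1 n2. n1 + n2 = n}"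
  have "?A \<subseteq> (\<lambda>(n1, n2). lambda_ind \<alpha> ?S (complete_multipartite [n1, n2])) ` ({..n} \<times> {..n})"
    by auto
  then have fin: "finite ?A" by (rule finite_subset) simp
  moreover have "?A \<noteq> {}" by (auto intro: exI[of _ n])
  ultimately have "Max ?A \<in> ?A" by (rule Max_in)
  then obtain n1 n2 where n12: "n1 + n2 = n" "Max ?A = lambda_ind \<alpha> ?S (complete_multipartite [n1, n2])"
    by blast
  show ?thesis
    unfolding spec_ind_def
  proof (rule Greatest_equality)
    have "pverts (complete_multipartite [n1, n2]) \<noteq> {}"
      using card_pverts_complete_bipartite[of n1 n2] n12 \<open>n \<ge> 1\<close> by auto
    from ex_nat_graph[OF pair_graph_complete_multipartite this \<open>\<alpha> \<ge> 1\<close>, of t]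
    show "Max ?A \<in> {lambda_ind \<alpha> ?S G | G :: nat pair_pre_digraph. pair_graph G \<and> card (pverts G) = n}"
      unfolding n12(2) card_pverts_complete_bipartite n12(1) by force
  next
    fix r assume "r \<in> {lambda_ind \<alpha> ?S G | G :: nat pair_pre_digraph. pair_graph G \<and> card (pverts G) = n}"
    then obtain G :: "nat pair_pre_digraph" where G: "pair_graph G" "card (pverts G) = n" "r = lambda_ind \<alpha> ?S G"
      by blast
    then have "pverts G \<noteq> {}" using \<open>n \<ge> 1\<close> by auto
    from lambda_ind_star_le_bipartite[OF G(1) this \<open>\<alpha> \<ge> 1\<close> \<open>t \<ge> 2\<close>] obtain m1 m2 where
      m: "m1 + m2 = n" "r \<le> lambda_ind \<alpha> ?S (complete_multipartite [m1, m2])"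
      using G by auto
    then have "lambda_ind \<alpha> ?S (complete_multipartite [m1, m2]) \<le> Max ?A"
      using fin by (intro Max_ge) auto
    with m show "r \<le> Max ?A" by simp
  qed
qed

end
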